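(* Let $\omega=1/16$, let $P^0=\{(x_i^0,y_i^0,z_i^0)\}_{i\in\mathbb{Z}}$ satisfy the smallness hypotheses (H) stated in the context, and let $P^{k+1}=S_{\mathrm H}(P^k)$ for $k\ge0$. Then the limit curve $\Gamma=(X,Y,Z)$ exists, with $X,Y\in C^1(\mathbb{R})$ generated by the four-point operator $L_4$ from $\{x_i^0\}$, $\{y_i^0\}$ (that is, $X$ and $Y$ are the uniform limits on compact intervals of the dyadically parametrised piecewise-linear interpolants of $(L_4)^kx^0$ and $(L_4)^ky^0$), and $Z\in C^0(\mathbb{R})$ the uniform limit on compact intervals of the dyadically parametrised piecewise-linear interpolants of $z^k$.
   Context: For a real sequence $u=\{u_i\}_{i\in\mathbb{Z}}$ the four-point operator $L_4$ with parameter $\omega$ is $(L_4u)_{2i}=u_i$, $(L_4u)_{2i+1}=-\omega u_{i-1}+(\tfrac12+\omega)u_i+(\tfrac12+\omega)u_{i+1}-\omega u_{i+2}$. The Heisenberg four-point subdivision operator $S_{\mathrm H}$ maps $P^k=\{(x_i^k,y_i^k,z_i^k)\}_{i\in\mathbb{Z}}\subset\mathbb{R}^3$ to $P^{k+1}$ defined by $P^{k+1}_{2i}=P^k_i$ and $P^{k+1}_{2i+1}=(X_{2i+1},Y_{2i+1},Z_{2i+1})$ with $X_{2i+1}=(L_4x^k)_{2i+1}$, $Y_{2i+1}=(L_4y^k)_{2i+1}$, $Z_{2i+1}=(L_4z^k)_{2i+1}+R_i^k$, where $R_i^k=\tfrac12(x_i^kb_i^k-y_i^ka_i^k)$, $a_i^k=X_{2i+1}-x_i^k$,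 $b_i^k=Y_{2i+1}-y_i^k$. Notation: $\|\Delta_hP\|_\infty=\sup_i(|x_{i+1}-x_i|+|y_{i+1}-y_i|)$ and $\|\Delta_h^2P\|_\infty=\sup_i(|x_{i+1}-2x_i+x_{i-1}|+|y_{i+1}-2y_i+y_{i-1}|)$. Hypotheses (H): $\sup_i\|P_i^0\|\le C$, $\|\Delta_hP^0\|_\infty\le\varepsilon_0$, $\|\Delta_h^2P^0\|_\infty\le\varepsilon_0$, for a fixed constant $C$ and a sufficiently small $\varepsilon_0>0$ depending only on $\omega=1/16$ (that is, there exists such an $\varepsilon_0$ for which the result holds). Dyadic parametrisation: the level-$k$ node with index $i$ is assigned the parameter value $t=i2^{-k}$; the piecewise-linear interpolant of a level-$k$ sequence $u^k$ takes the value $u_i^k$ at $i2^{-k}$ and is affine between consecutive nodes. *)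

theory Defs
  imports "HOL-Analysis.Analysis" "HOL-Library.Extended_Real"
begin

text \<open>Bi-infinite sequences are functions on \<^typ>\<open>int\<close>; a control polygon is a function from
  \<^typ>\<open>int\<close> to triples, whose product-type norm is the Euclidean norm of three-space.
  For integers, \<open>j div 2\<close> is the floor of \<open>j/2\<close>, so \<open>i = j div 2\<close> both when \<open>j = 2i\<close> and when
  \<open>j = 2i+1\<close>.\<close>

definition L4 :: "real \<Rightarrow> (int \<Rightarrow> real) \<Rightarrow> (int \<Rightarrow> real)" where
  "L4 \<omega> u j = (let i = j div 2 in
     if even j then u i
     else - \<omega> * u (i - 1) + (1/2 + \<omega>) * u i + (1/2 + \<omega>) * u (i + 1) - \<omega> * u (i + 2))"

lemma L4_even: "L4 \<omega> u (2 * i) = u i"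
  by (simp add: L4_def)

lemma L4_odd: "L4 \<omega> u (2 * i + 1) =
    - \<omega> * u (i - 1) + (1/2 + \<omega>) * u i + (1/2 + \<omega>) * u (i + 1) - \<omega> * u (i + 2)"
  by (simp add: L4_def)

type_synonym point = "real \<times> real \<times> real"

definition xs_of :: "(int \<Rightarrow> point) \<Rightarrow> int \<Rightarrow> real" where
  "xs_of P i = fst (P i)"

definition ys_of :: "(int \<Rightarrow> point) \<Rightarrow> int \<Rightarrow> real" where
  "ys_of P i = fst (snd (P i))"

definition zs_of :: "(int \<Rightarrow> point) \<Rightarrow> int \<Rightarrow> real" where
  "zs_of P i = snd (snd (P i))"

definition heis_correction :: "real \<Rightarrow> (int \<Rightarrow> point) \<Rightarrow> int \<Rightarrow> real" where
  "heis_correction \<omega> P i =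
    (let a = L4 \<omega> (xs_of P) (2 * i + 1) - xs_of P i;
         b = L4 \<omega> (ys_of P) (2 * i + 1) - ys_of P i
     in 1/2 * (xs_of P i * b - ys_of P i * a))"

definition S_H :: "real \<Rightarrow> (int \<Rightarrow> point) \<Rightarrow> (int \<Rightarrow> point)" where
  "S_H \<omega> P j =
    (if even j then P (j div 2)
     else (L4 \<omega> (xs_of P) j, L4 \<omega> (ys_of P) j,
           L4 \<omega> (zs_of P) j + heis_correction \<omega> P (j div 2)))"

lemma S_H_even: "S_H \<omega> P (2 * i) = P i"
  by (simp add: S_H_def)

lemma S_H_odd: "S_H \<omega> P (2 * i + 1) =
    (L4 \<omega> (xs_of P) (2 * i + 1), L4 \<omega> (ys_of P) (2 * i + 1),
     L4 \<omega> (zs_of P) (2 * i + 1) + heis_correction \<omega> P i)"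
  by (simp add: S_H_def)

text \<open>The suprema are taken in the extended reals: on \<^typ>\<open>real\<close> the supremum of an unbounded
  set is an unspecified number, whereas here it is infinite.\<close>

definition sup_norm :: "(int \<Rightarrow> point) \<Rightarrow> ereal" where
  "sup_norm P = (SUP i. ereal (norm (P i)))"

definition norm_Delta_h :: "(int \<Rightarrow> point) \<Rightarrow> ereal" where
  "norm_Delta_h P =
    (SUP i. ereal (\<bar>xs_of P (i + 1) - xs_of P i\<bar> + \<bar>ys_of P (i + 1) - ys_of P i\<bar>))"

definition norm_Delta2_h :: "(int \<Rightarrow> point) \<Rightarrow> ereal" where
  "norm_Delta2_h P =
    (SUP i. ereal (\<bar>xs_of P (i + 1) - 2 * xs_of P i + xs_of P (i - 1)\<bar>
                 + \<bar>ys_of P (i + 1) - 2 * ys_of P i + ys_of P (i - 1)\<bar>))"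

definition pl_interp :: "nat \<Rightarrow> (int \<Rightarrow> 'a::real_vector) \<Rightarrow> real \<Rightarrow> 'a" where
  "pl_interp k u t =
    (let i = \<lfloor>t * 2 ^ k\<rfloor>; s = t * 2 ^ k - of_int i
     in (1 - s) *\<^sub>R u i + s *\<^sub>R u (i + 1))"

lemma pl_interp_node: "pl_interp k u (of_int i / 2 ^ k) = u i"
  by (simp add: pl_interp_def Let_def)

lemma pl_interp_affine:
  assumes "0 \<le> s" "s \<le> 1"
  shows "pl_interp k u ((of_int i + s) / 2 ^ k) = (1 - s) *\<^sub>R u i + s *\<^sub>R u (i + 1)"
proof (cases "s = 1")
  case True
  then show ?thesis using pl_interp_node[of k u "i + 1"] by simp
next
  case False
  then have "\<lfloor>of_int i + s\<rfloor> = i" using assms by (simp add: floor_eq_iff)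
  then show ?thesis by (simp add: pl_interp_def Let_def)
qed

text \<open>\<open>u k\<close> is the level-\<open>k\<close> sequence; the limit function is \<open>f\<close>.\<close>

definition dyadic_limit :: "(nat \<Rightarrow> int \<Rightarrow> 'a::real_normed_vector) \<Rightarrow> (real \<Rightarrow> 'a) \<Rightarrow> bool" where
  "dyadic_limit u f \<longleftrightarrow>
    (\<forall>a b. uniform_limit {a..b} (\<lambda>k. pl_interp k (u k)) f sequentially)"

end

theory Submission
  imports Defs
begin

text \<open>
  Write \<open>\<Delta>\<close> for first differences. The four-point operator with parameter \<open>1/16\<close> multiplies
  \<open>sup \<bar>\<Delta>u\<bar>\<close> by at most \<open>5/8\<close>, and every value at level \<open>k + 1\<close> lies within a multiple of
  \<open>sup \<bar>\<Delta>u\<bar>\<close> of the value at the left end of its level-\<open>k\<close> cell. Geometric decay of \<open>\<Delta>\<close> therefore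
  makes consecutive piecewise-linear interpolants differ by a summable amount, uniformly on the
  whole line, and the interpolants converge uniformly to a continuous function
  (\<open>interpolants_converge_uniformly\<close>).

  The coordinates \<open>x\<close> and \<open>y\<close> evolve under the linear scheme alone. They stay bounded and their
  differences decay like \<open>(3/4) ^ k\<close>, so the Heisenberg correction, which is bilinear in values and
  differences, is also \<open>O((3/4) ^ k)\<close>. Thus \<open>z\<close> follows the four-point scheme up to a geometrically
  small perturbation, which the contraction absorbs (\<open>perturbed_L4_geometric_bounds\<close>).

  Differentiability of \<open>X\<close> and \<open>Y\<close> comes from the divided differences \<open>e k = 2 ^ k \<Delta>(u k)\<close>. Their own
  differences satisfy a linear recurrence that is not contractive in one step but has factor \<open>3/4\<close>
  over two steps (\<open>two_step_decay\<close>). Hence the interpolants of \<open>e k\<close> converge uniformly to a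
  continuous \<open>g\<close>, and since the slopes of the interpolants of \<open>u k\<close> are nodal values of \<open>e k\<close>, the
  limit of the latter is an antiderivative of \<open>g\<close> (\<open>limit_of_interpolants_has_derivative\<close>).
\<close>

section \<open>Piecewise-linear interpolants\<close>

lemma pl_interp_frac:
  "pl_interp k u t =
    u \<lfloor>t * 2 ^ k\<rfloor> + frac (t * 2 ^ k) *\<^sub>R (u (\<lfloor>t * 2 ^ k\<rfloor> + 1) - u \<lfloor>t * 2 ^ k\<rfloor>)"
  by (simp add: pl_interp_def Let_def frac_def algebra_simps)

lemma pl_interp_Pair:
  "pl_interp k (\<lambda>i. (u i, v i)) t = (pl_interp k u t, pl_interp k v t)"
  by (simp add: pl_interp_def Let_def)

lemma norm_pl_interp_minus_node:
  fixes u :: "int \<Rightarrow> 'a::real_normed_vector"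
  assumes "\<And>i. norm (u (i + 1) - u i) \<le> D"
  shows "norm (pl_interp k u t - u \<lfloor>t * 2 ^ k\<rfloor>) \<le> D"
proof -
  have "norm (pl_interp k u t - u \<lfloor>t * 2 ^ k\<rfloor>)
      = frac (t * 2 ^ k) * norm (u (\<lfloor>t * 2 ^ k\<rfloor> + 1) - u \<lfloor>t * 2 ^ k\<rfloor>)"
    by (simp add: pl_interp_frac)
  also have "\<dots> \<le> 1 * D"
    using assms by (intro mult_mono) (auto simp: frac_lt_1 less_imp_le)
  finally show ?thesis by simp
qed

text \<open>The definition of the interpolant jumps formally at every node because of the floor.
  Centring the formula at a node \<open>m\<close> and covering both adjacent cells at once removes the floor,
  which makes continuity visible.\<close>

lemma pl_interp_two_cells:
  assumes "\<bar>t * 2 ^ k - of_int m\<bar> < 1"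
  shows "pl_interp k u t = u m + max 0 (t * 2 ^ k - of_int m) *\<^sub>R (u (m + 1) - u m)
                              + min 0 (t * 2 ^ k - of_int m) *\<^sub>R (u m - u (m - 1))"
proof (cases "of_int m \<le> t * 2 ^ k")
  case True
  then have "\<lfloor>t * 2 ^ k\<rfloor> = m" using assms by (intro floor_unique) auto
  then show ?thesis using True by (simp add: pl_interp_frac frac_def)
next
  case False
  then have "\<lfloor>t * 2 ^ k\<rfloor> = m - 1" using assms by (intro floor_unique) auto
  then have "pl_interp k u t = u (m - 1) + (t * 2 ^ k - of_int (m - 1)) *\<^sub>R (u m - u (m - 1))"
    unfolding pl_interp_frac frac_def by simp
  then show ?thesis using False by (simp add: algebra_simps)
qed

lemma continuous_pl_interp:
  fixes u :: "int \<Rightarrow> 'a::real_normed_vector"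
  shows "continuous_on A (pl_interp k u)"
proof (rule continuous_at_imp_continuous_on, rule ballI)
  fix t :: real
  define m where "m = \<lfloor>t * 2 ^ k\<rfloor>"
  define S where "S = {s::real. \<bar>s * 2 ^ k - of_int m\<bar> < 1}"
  define q where "q s = u m + max 0 (s * 2 ^ k - of_int m) *\<^sub>R (u (m + 1) - u m)
                              + min 0 (s * 2 ^ k - of_int m) *\<^sub>R (u m - u (m - 1))" for s
  have "open S" unfolding S_def by (intro open_Collect_less continuous_intros)
  moreover have "t \<in> S"
    unfolding S_def m_def by (simp add: abs_less_iff) linarith
  moreover have "continuous_on S q" unfolding q_def by (intro continuous_intros)
  ultimately have "isCont q t" by (simp add: continuous_on_eq_continuous_at)
  moreover have "eventually (\<lambda>s. pl_interp k u s = q s) (nhds t)"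
    unfolding eventually_nhds using \<open>open S\<close> \<open>t \<in> S\<close>
    by (auto intro!: exI[of _ S] simp: S_def q_def pl_interp_two_cells)
  ultimately show "isCont (pl_interp k u) t"
    using isCont_cong by fast
qed

lemma pl_interp_has_vector_derivative:
  fixes u :: "int \<Rightarrow> 'a::real_normed_vector"
  assumes "t * 2 ^ k \<notin> \<int>"
  shows "(pl_interp k u has_vector_derivative
            2 ^ k *\<^sub>R (u (\<lfloor>t * 2 ^ k\<rfloor> + 1) - u \<lfloor>t * 2 ^ k\<rfloor>)) (at t)"
proof -
  define m where "m = \<lfloor>t * 2 ^ k\<rfloor>"
  define S where "S = {s::real. of_int m < s * 2 ^ k \<and> s * 2 ^ k < of_int m + 1}"
  have "open S"
    unfolding S_def by (intro open_Collect_conj open_Collect_less continuous_intros)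
  have "of_int m \<noteq> t * 2 ^ k" using assms by (metis Ints_of_int)
  then have "of_int m < t * 2 ^ k"
    unfolding m_def using of_int_floor_le[of "t * 2 ^ k"] by linarith
  then have "t \<in> S" unfolding S_def m_def by simp
  have "((\<lambda>s. u m + (s * 2 ^ k - of_int m) *\<^sub>R (u (m + 1) - u m))
           has_vector_derivative 2 ^ k *\<^sub>R (u (m + 1) - u m)) (at t)"
    by (auto intro!: derivative_eq_intros)
  then have "(pl_interp k u has_vector_derivative 2 ^ k *\<^sub>R (u (m + 1) - u m)) (at t)"
  proof (rule has_vector_derivative_transform_within_open[OF _ \<open>open S\<close> \<open>t \<in> S\<close>])
    fix s assume "s \<in> S"
    then have "\<lfloor>s * 2 ^ k\<rfloor> = m" unfolding S_def by (intro floor_unique) auto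
    then show "u m + (s * 2 ^ k - of_int m) *\<^sub>R (u (m + 1) - u m) = pl_interp k u s"
      by (simp add: pl_interp_frac frac_def)
  qed
  then show ?thesis by (simp add: m_def)
qed

text \<open>The slope of an interpolant is a step function with finitely many jumps on a compact
  interval, so the fundamental theorem of calculus applies to it.\<close>

lemma pl_interp_slope_has_integral:
  fixes u :: "int \<Rightarrow> 'a::banach"
  assumes "a \<le> b"
  shows "((\<lambda>t. 2 ^ k *\<^sub>R (u (\<lfloor>t * 2 ^ k\<rfloor> + 1) - u \<lfloor>t * 2 ^ k\<rfloor>)) has_integral
            (pl_interp k u b - pl_interp k u a)) {a..b}"
proof (rule fundamental_theorem_of_calculus_strong)
  let ?N = "(\<lambda>i::int. of_int i / 2 ^ k :: real) ` {\<lfloor>a * 2 ^ k\<rfloor>..\<lceil>b * 2 ^ k\<rceil>}"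
  show "finite ?N" by simp
  show "(pl_interp k u has_vector_derivative
            2 ^ k *\<^sub>R (u (\<lfloor>t * 2 ^ k\<rfloor> + 1) - u \<lfloor>t * 2 ^ k\<rfloor>)) (at t)"
    if t: "t \<in> {a..b} - ?N" for t
  proof (rule pl_interp_has_vector_derivative, rule notI)
    assume "t * 2 ^ k \<in> \<int>"
    then obtain i where i: "t * 2 ^ k = of_int i" by (elim Ints_cases)
    have "a * 2 ^ k \<le> t * 2 ^ k" "t * 2 ^ k \<le> b * 2 ^ k" using t by auto
    then have "i \<in> {\<lfloor>a * 2 ^ k\<rfloor>..\<lceil>b * 2 ^ k\<rceil>}" unfolding i by (auto simp: floor_le_iff le_ceiling_iff)
    moreover have "t = of_int i / 2 ^ k" using i by (simp add: field_simps)
    ultimately show False using t by blast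
  qed
qed (use assms continuous_pl_interp in auto)


section \<open>Limits of dyadic interpolants\<close>

lemma floor_double_div_2: "\<lfloor>2 * x\<rfloor> div 2 = \<lfloor>x\<rfloor>" for x :: real
proof -
  have "2 * (\<lfloor>2 * x\<rfloor> div 2) \<le> \<lfloor>2 * x\<rfloor>" "\<lfloor>2 * x\<rfloor> < 2 * (\<lfloor>2 * x\<rfloor> div 2) + 2" by auto
  then have "\<lfloor>x\<rfloor> = \<lfloor>2 * x\<rfloor> div 2" by (intro floor_unique) linarith+
  then show ?thesis by simp
qed

text \<open>A value at level \<open>k + 1\<close> is compared with the value at its parent \<open>j div 2\<close>, which is the
  left end of the level-\<open>k\<close> cell that contains it. Both interpolants at \<open>t\<close> are then close to the
  same nodal value, so consecutive interpolants differ by a geometrically small amount and the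
  Weierstrass test applies to the telescoping series. Divided differences change even at the old
  nodes; comparison with the parent covers them in the same way as the points.\<close>

lemma interpolants_converge_uniformly:
  fixes v :: "nat \<Rightarrow> int \<Rightarrow> 'a::banach"
  assumes r: "0 \<le> r" "r < 1"
    and parent: "\<And>k j. norm (v (Suc k) j - v k (j div 2)) \<le> c * r ^ k"
    and step: "\<And>k i. norm (v k (i + 1) - v k i) \<le> c * r ^ k"
  shows "\<exists>f. continuous_on UNIV f \<and> uniform_limit UNIV (\<lambda>k. pl_interp k (v k)) f sequentially"
proof -
  let ?p = "\<lambda>k. pl_interp k (v k)"
  have diff: "norm (?p (Suc k) t - ?p k t) \<le> 3 * c * r ^ k" for k t
  proof -
    let ?i = "\<lfloor>t * 2 ^ k\<rfloor>" and ?j = "\<lfloor>t * 2 ^ Suc k\<rfloor>"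
    have j: "?j div 2 = ?i"
      using floor_double_div_2[of "t * 2 ^ k"] by (simp add: mult.left_commute)
    have "0 \<le> c * r ^ k" using step[of k 0] norm_ge_zero order_trans by blast
    then have "c * r ^ Suc k \<le> c * r ^ k"
      using mult_right_mono[of r 1 "c * r ^ k"] r by (simp add: mult_ac)
    moreover have "norm (?p (Suc k) t - v (Suc k) ?j) \<le> c * r ^ Suc k"
      by (rule norm_pl_interp_minus_node) (rule step)
    moreover have "norm (v (Suc k) ?j - v k ?i) \<le> c * r ^ k"
      using parent[of k ?j] j by simp
    moreover have "norm (v k ?i - ?p k t) \<le> c * r ^ k"
      using norm_pl_interp_minus_node[of "v k", OF step] by (simp add: norm_minus_commute)
    moreover have "norm (?p (Suc k) t - ?p k t) \<le> norm (?p (Suc k) t - v (Suc k) ?j)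
        + norm (v (Suc k) ?j - v k ?i) + norm (v k ?i - ?p k t)"
      by norm
    ultimately show ?thesis by linarith
  qed
  have "summable (\<lambda>k. 3 * c * r ^ k)"
    using r by (intro summable_mult summable_geometric) simp
  then have "uniform_limit UNIV (\<lambda>n t. \<Sum>k<n. ?p (Suc k) t - ?p k t)
      (\<lambda>t. \<Sum>k. ?p (Suc k) t - ?p k t) sequentially"
    using diff by (intro Weierstrass_m_test[where M = "\<lambda>k. 3 * c * r ^ k"]) auto
  then have "uniform_limit UNIV (\<lambda>n t. ?p 0 t + (\<Sum>k<n. ?p (Suc k) t - ?p k t))
      (\<lambda>t. ?p 0 t + (\<Sum>k. ?p (Suc k) t - ?p k t)) sequentially"
    by (intro uniform_limit_add uniform_limit_const)
  then have lim: "uniform_limit UNIV ?p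
      (\<lambda>t. ?p 0 t + (\<Sum>k. ?p (Suc k) t - ?p k t)) sequentially"
    by (subst (asm) sum_lessThan_telescope) simp
  moreover have "continuous_on UNIV (\<lambda>t. ?p 0 t + (\<Sum>k. ?p (Suc k) t - ?p k t))"
    by (rule uniform_limit_theorem[OF _ lim]) (simp_all add: continuous_pl_interp)
  ultimately show ?thesis by blast
qed

text \<open>If the divided differences \<open>e k\<close> of \<open>u k\<close> have a uniform limit \<open>g\<close>, then so do the slopes
  of the interpolants of \<open>u k\<close>, since a slope is a nodal value of \<open>e k\<close>. Passing to the limit in
  the fundamental theorem of calculus gives \<open>f b - f a = \<integral> g\<close>, so \<open>f\<close> has derivative \<open>g\<close>.\<close>

lemma limit_of_interpolants_has_derivative:
  fixes u e :: "nat \<Rightarrow> int \<Rightarrow> 'a::banach"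
  assumes e: "\<And>k i. e k i = 2 ^ k *\<^sub>R (u k (i + 1) - u k i)"
    and step: "\<And>k i. norm (e k (i + 1) - e k i) \<le> d k" and "d \<longlonglongrightarrow> 0"
    and lim_u: "\<And>t. (\<lambda>k. pl_interp k (u k) t) \<longlonglongrightarrow> f t"
    and lim_e: "uniform_limit UNIV (\<lambda>k. pl_interp k (e k)) g sequentially"
    and g: "continuous_on UNIV g"
  shows "(f has_vector_derivative g t) (at t)"
proof -
  have increment: "f b - f a = integral {a..b} g" if "a \<le> b" for a b
  proof -
    let ?I = "integral {a..b} g"
    let ?D = "\<lambda>k. pl_interp k (u k) b - pl_interp k (u k) a - ?I"
    have int_g: "(g has_integral ?I) {a..b}"
      using g by (intro integrable_integral integrable_continuous_real)
        (rule continuous_on_subset, auto)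
    have "?D \<longlonglongrightarrow> 0"
    proof (rule LIMSEQ_I)
      fix \<epsilon> :: real assume "\<epsilon> > 0"
      \<comment> \<open>The added \<open>1\<close> keeps the denominator positive when \<open>a = b\<close>.\<close>
      define \<eta> where "\<eta> = \<epsilon> / (2 * (b - a + 1))"
      have "\<eta> > 0" using \<open>\<epsilon> > 0\<close> \<open>a \<le> b\<close> by (simp add: \<eta>_def)
      have "eventually (\<lambda>k. d k < \<eta>) sequentially"
        using \<open>d \<longlonglongrightarrow> 0\<close> \<open>\<eta> > 0\<close> by (rule order_tendstoD)
      moreover have "eventually (\<lambda>k. \<forall>t\<in>UNIV. dist (pl_interp k (e k) t) (g t) < \<eta>) sequentially"
        using lim_e \<open>\<eta> > 0\<close> by (rule uniform_limitD)
      ultimately have "eventually (\<lambda>k. norm (?D k) < \<epsilon>) sequentially"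
      proof eventually_elim
        case (elim k)
        have bound: "norm (e k \<lfloor>t * 2 ^ k\<rfloor> - g t) \<le> 2 * \<eta>" for t
        proof -
          have "norm (pl_interp k (e k) t - e k \<lfloor>t * 2 ^ k\<rfloor>) \<le> d k"
            by (rule norm_pl_interp_minus_node) (rule step)
          moreover have "norm (pl_interp k (e k) t - g t) < \<eta>"
            using elim(2) by (auto simp: dist_norm)
          ultimately show ?thesis
            using elim(1) norm_triangle_ineq4[of "pl_interp k (e k) t - g t"
                "pl_interp k (e k) t - e k \<lfloor>t * 2 ^ k\<rfloor>"]
            by simp
        qed
        have "((\<lambda>t. e k \<lfloor>t * 2 ^ k\<rfloor> - g t) has_integral ?D k) {a..b}"
          unfolding e by (intro has_integral_diff int_g pl_interp_slope_has_integral \<open>a \<le> b\<close>)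
        then have "norm (?D k) \<le> 2 * \<eta> * measure lborel (cbox a b)"
          using bound \<open>\<eta> > 0\<close>
          by (intro has_integral_bound[of _ "\<lambda>t. e k \<lfloor>t * 2 ^ k\<rfloor> - g t"]) auto
        also have "\<dots> = 2 * \<eta> * (b - a)" using \<open>a \<le> b\<close> by simp
        also have "\<dots> < 2 * \<eta> * (b - a + 1)" using \<open>\<eta> > 0\<close> by simp
        also have "\<dots> = \<epsilon>"
          using \<open>a \<le> b\<close> unfolding \<eta>_def by (simp add: divide_eq_eq)
        finally show "norm (?D k) < \<epsilon>" .
      qed
      then show "\<exists>n0. \<forall>n\<ge>n0. norm (?D n - 0) < \<epsilon>" by (simp add: eventually_sequentially)
    qed
    moreover have "?D \<longlonglongrightarrow> f b - f a - ?I" by (intro tendsto_intros lim_u)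
    ultimately show ?thesis using LIMSEQ_unique by fastforce
  qed
  have "((\<lambda>s. f (t - 1) + integral {t - 1..s} g) has_vector_derivative g t)
      (at t within {t - 1..t + 1})"
    using integral_has_vector_derivative[of "t - 1" "t + 1" g t] continuous_on_subset[OF g]
    by (auto intro!: derivative_eq_intros)
  then have "((\<lambda>s. f (t - 1) + integral {t - 1..s} g) has_vector_derivative g t) (at t)"
    by (simp add: at_within_Icc_at)
  then show ?thesis
  proof (rule has_vector_derivative_transform_within_open[of _ _ _ "{t - 1<..<t + 1}"])
    show "f (t - 1) + integral {t - 1..s} g = f s" if "s \<in> {t - 1<..<t + 1}" for s
      using increment[of "t - 1" s] that by (simp add: algebra_simps)
  qed auto
qed


section \<open>The four-point scheme with parameter 1/16\<close>

lemma L4_odd_sixteenth: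
  "L4 (1/16) u (2 * i + 1) = (9 * (u i + u (i + 1)) - u (i - 1) - u (i + 2)) / 16"
  unfolding L4_odd by (simp add: field_simps)

lemma L4_near_parent:
  assumes "\<And>i. \<bar>u (i + 1) - u i\<bar> \<le> D"
  shows "\<bar>L4 (1/16) u j - u (j div 2)\<bar> \<le> 5/8 * D"
proof (cases "even j")
  case True
  then show ?thesis using assms[of 0] by (simp add: L4_def)
next
  case False
  then obtain i where j: "j = 2 * i + 1" by (elim oddE)
  have "\<bar>L4 (1/16) u (2 * i + 1) - u i\<bar> \<le> 5/8 * D"
    unfolding L4_odd_sixteenth
    using assms[of "i - 1"] assms[of i] assms[of "i + 1"]
    unfolding diff_add_cancel add.assoc one_add_one by argo
  then show ?thesis by (simp add: j)
qed

lemma L4_difference_contraction: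
  assumes "\<And>i. \<bar>u (i + 1) - u i\<bar> \<le> D"
  shows "\<bar>L4 (1/16) u (j + 1) - L4 (1/16) u j\<bar> \<le> 5/8 * D"
proof (cases "even j")
  case True
  then obtain i where j: "j = 2 * i" by (elim evenE)
  show ?thesis
    unfolding j L4_odd_sixteenth L4_even
    using assms[of "i - 1"] assms[of i] assms[of "i + 1"]
    unfolding diff_add_cancel add.assoc one_add_one by argo
next
  case False
  then obtain i where j: "j = 2 * i + 1" by (elim oddE)
  have "L4 (1/16) u (j + 1) = u (i + 1)" using L4_even[of "1/16" u "i + 1"] by (simp add: j algebra_simps)
  then show ?thesis
    unfolding j L4_odd_sixteenth
    using assms[of "i - 1"] assms[of i] assms[of "i + 1"]
    unfolding diff_add_cancel add.assoc one_add_one by argo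
qed

text \<open>The contraction factor \<open>5/8\<close> lies strictly below the rate \<open>3/4\<close> at which the perturbations
  decay. Two neighbouring values contribute a perturbation \<open>2 M\<close>, and the gap \<open>3/4 - 5/8 = 1/8\<close>
  absorbs it once the constant is at least \<open>16 M\<close>. With equal rates a factor \<open>k\<close> would appear.\<close>

lemma perturbed_L4_geometric_bounds:
  fixes v :: "nat \<Rightarrow> int \<Rightarrow> real"
  assumes perturb: "\<And>k j. \<bar>v (Suc k) j - L4 (1/16) (v k) j\<bar> \<le> M * (3/4) ^ k"
    and init: "\<And>i. \<bar>v 0 (i + 1) - v 0 i\<bar> \<le> B"
  shows "\<bar>v k (i + 1) - v k i\<bar> \<le> (16 * M + B) * (3/4) ^ k"
    and "\<bar>v (Suc k) j - v k (j div 2)\<bar> \<le> (16 * M + B) * (3/4) ^ k"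
proof -
  have "0 \<le> M" using perturb[of 0 0] by simp
  have "0 \<le> B" using init[of 0] by simp
  have step: "\<bar>v k (i + 1) - v k i\<bar> \<le> (16 * M + B) * (3/4) ^ k" for k i
  proof (induction k arbitrary: i)
    case 0
    then show ?case using init[of i] \<open>0 \<le> M\<close> by simp
  next
    case (Suc k)
    have "\<bar>L4 (1/16) (v k) (i + 1) - L4 (1/16) (v k) i\<bar> \<le> 5/8 * ((16 * M + B) * (3/4) ^ k)"
      by (rule L4_difference_contraction) (rule Suc.IH)
    then have "\<bar>v (Suc k) (i + 1) - v (Suc k) i\<bar>
        \<le> 5/8 * ((16 * M + B) * (3/4) ^ k) + 2 * (M * (3/4) ^ k)"
      using perturb[of k i] perturb[of k "i + 1"] by linarith
    also have "\<dots> \<le> 3/4 * ((16 * M + B) * (3/4) ^ k)"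
      using \<open>0 \<le> B\<close> by (simp add: algebra_simps)
    finally show ?case by (simp add: mult_ac)
  qed
  then show "\<bar>v k (i + 1) - v k i\<bar> \<le> (16 * M + B) * (3/4) ^ k" .
  have "\<bar>L4 (1/16) (v k) j - v k (j div 2)\<bar> \<le> 5/8 * ((16 * M + B) * (3/4) ^ k)"
    by (rule L4_near_parent) (rule step)
  then have "\<bar>v (Suc k) j - v k (j div 2)\<bar>
      \<le> 5/8 * ((16 * M + B) * (3/4) ^ k) + M * (3/4) ^ k"
    using perturb[of k j] by linarith
  also have "\<dots> \<le> (16 * M + B) * (3/4) ^ k"
    using \<open>0 \<le> B\<close> \<open>0 \<le> M\<close> by (simp add: algebra_simps)
  finally show "\<bar>v (Suc k) j - v k (j div 2)\<bar> \<le> (16 * M + B) * (3/4) ^ k" .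
qed

text \<open>The displacements from parent to child add up to at most \<open>c \<Sum> (3/4) ^ k = 4 c\<close>; the induction
  carries the partial sums of this series.\<close>

lemma bounded_of_near_parent:
  fixes v :: "nat \<Rightarrow> int \<Rightarrow> real"
  assumes "\<And>i. \<bar>v 0 i\<bar> \<le> C"
    and parent: "\<And>k j. \<bar>v (Suc k) j - v k (j div 2)\<bar> \<le> c * (3/4) ^ k"
  shows "\<bar>v k i\<bar> \<le> C + 4 * c"
proof -
  have "0 \<le> c" using parent[of 0 0] by simp
  have "\<bar>v k i\<bar> \<le> C + 4 * c * (1 - (3/4) ^ k)"
  proof (induction k arbitrary: i)
    case 0
    then show ?case using assms(1) by simp
  next
    case (Suc k)
    have "\<bar>v (Suc k) i\<bar> \<le> C + 4 * c * (1 - (3/4) ^ k) + c * (3/4) ^ k"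
      using Suc.IH[of "i div 2"] parent[of k i] by linarith
    then show ?case by (simp add: algebra_simps)
  qed
  also have "\<dots> \<le> C + 4 * c" using \<open>0 \<le> c\<close> by (simp add: algebra_simps)
  finally show ?thesis .
qed


section \<open>Divided differences of the four-point scheme\<close>

text \<open>This recurrence governs second differences, rescaled by \<open>2 ^ k\<close> at level \<open>k\<close>. The odd rule
  \<open>(-1/8, 3/4, -1/8)\<close> has norm \<open>1\<close>, so one step gives no decay. Every rule of the two-step scheme
  has norm at most \<open>3/4\<close>; the four residues modulo \<open>4\<close> give \<open>5/16\<close>, \<open>1/4\<close>, \<open>5/16\<close> and \<open>3/4\<close>. Since
  \<open>(9/10)\<^sup>2 > 3/4\<close>, the sequence decays like \<open>(9/10) ^ k\<close>; the factor \<open>10/9\<close> makes the bound hold at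
  level \<open>1\<close>, where nothing has been gained yet.\<close>

lemma two_step_decay:
  fixes f :: "nat \<Rightarrow> int \<Rightarrow> real"
  assumes even: "\<And>k i. f (Suc k) (2 * i) = (f k (i - 1) + f k i) / 4"
    and odd: "\<And>k i. f (Suc k) (2 * i + 1) = (6 * f k i - f k (i - 1) - f k (i + 1)) / 8"
    and init: "\<And>i. \<bar>f 0 i\<bar> \<le> B"
  shows "\<bar>f k i\<bar> \<le> 10/9 * B * (9/10) ^ k"
proof -
  have "0 \<le> B" using init[of 0] by linarith
  have one: "\<bar>f (Suc k) j\<bar> \<le> D" if D: "\<And>i. \<bar>f k i\<bar> \<le> D" for k j D
  proof (cases "even j")
    case True
    then obtain i where "j = 2 * i" by (elim evenE)
    show ?thesis using D[of "i - 1"] D[of i] unfolding \<open>j = 2 * i\<close> even by argo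
  next
    case False
    then obtain i where "j = 2 * i + 1" by (elim oddE)
    show ?thesis
      using D[of "i - 1"] D[of i] D[of "i + 1"] unfolding \<open>j = 2 * i + 1\<close> odd by argo
  qed
  have two: "\<bar>f (Suc (Suc k)) j\<bar> \<le> 3/4 * D" if D: "\<And>i. \<bar>f k i\<bar> \<le> D" for k j D
  proof -
    define i where "i = j div 4"
    \<comment> \<open>The four equations \<open>r0\<close> to \<open>r3\<close> are the rules of the two-step scheme.\<close>
    have prev: "f (Suc k) (2 * i - 1) = (6 * f k (i - 1) - f k (i - 2) - f k i) / 8"
      using odd[of k "i - 1"] by simp
    have succ: "f (Suc k) (2 * i + 1 + 1) = (f k i + f k (i + 1)) / 4"
      using even[of k "i + 1"] by (simp add: algebra_simps)
    have r0: "f (Suc (Suc k)) (2 * (2 * i)) = (8 * f k (i - 1) + f k i - f k (i - 2)) / 32"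
      unfolding even[of "Suc k"] even[of k] prev by (simp add: field_simps)
    have r1: "f (Suc (Suc k)) (2 * (2 * i) + 1)
        = (f k (i - 2) + 7 * f k (i - 1) + 7 * f k i + f k (i + 1)) / 64"
      unfolding odd[of "Suc k"] even[of k] odd[of k] prev by (simp add: field_simps)
    have r2: "f (Suc (Suc k)) (2 * (2 * i + 1)) = (f k (i - 1) + 8 * f k i - f k (i + 1)) / 32"
      unfolding even[of "Suc k"] add_diff_cancel_right' even[of k] odd[of k]
      by (simp add: field_simps)
    have r3: "f (Suc (Suc k)) (2 * (2 * i + 1) + 1)
        = (4 * f k i - f k (i - 1) - f k (i + 1)) / 8"
      unfolding odd[of "Suc k"] add_diff_cancel_right' even[of k] odd[of k] succ
      by (simp add: field_simps)
    note bounds = D[of "i - 2"] D[of "i - 1"] D[of i] D[of "i + 1"]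
    have "j = 2 * (2 * i) \<or> j = 2 * (2 * i) + 1 \<or> j = 2 * (2 * i + 1) \<or> j = 2 * (2 * i + 1) + 1"
      unfolding i_def by presburger
    then consider "j = 2 * (2 * i)" | "j = 2 * (2 * i) + 1" | "j = 2 * (2 * i + 1)"
      | "j = 2 * (2 * i + 1) + 1"
      by blast
    then show ?thesis
    proof cases
      case 1 show ?thesis using bounds unfolding 1 r0 by argo
    next
      case 2 show ?thesis using bounds unfolding 2 r1 by argo
    next
      case 3 show ?thesis using bounds unfolding 3 r2 by argo
    next
      case 4 show ?thesis using bounds unfolding 4 r3 by argo
    qed
  qed
  have "(\<forall>i. \<bar>f k i\<bar> \<le> 10/9 * B * (9/10) ^ k) \<and>
        (\<forall>i. \<bar>f (Suc k) i\<bar> \<le> 10/9 * B * (9/10) ^ Suc k)"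
  proof (induction k)
    case 0
    have "\<bar>f 0 i\<bar> \<le> 10/9 * B" for i using init[of i] \<open>0 \<le> B\<close> by linarith
    then show ?case using one[of 0 B] init by simp
  next
    case (Suc k)
    have "\<bar>f (Suc (Suc k)) i\<bar> \<le> 3/4 * (10/9 * B * (9/10) ^ k)" for i
      using Suc.IH by (intro two) blast
    moreover have "3/4 * (10/9 * B * (9/10) ^ k) \<le> 10/9 * B * (9/10) ^ Suc (Suc k)"
      using \<open>0 \<le> B\<close> by simp
    ultimately have "\<forall>i. \<bar>f (Suc (Suc k)) i\<bar> \<le> 10/9 * B * (9/10) ^ Suc (Suc k)"
      using order_trans by blast
    then show ?case using Suc.IH by blast
  qed
  then show ?thesis by blast
qed

text \<open>The rescaled second differences of \<open>u\<close> are the first differences of \<open>e\<close>, and they obey the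
  recurrence above. Each child of \<open>e k i\<close> moves by an eighth of \<open>e k (i + 1) - e k (i - 1)\<close>, which
  is a sum of two such differences, so closeness to the parent inherits their decay.\<close>

lemma L4_divided_difference_bounds:
  fixes u e :: "nat \<Rightarrow> int \<Rightarrow> real"
  assumes u: "\<And>k. u (Suc k) = L4 (1/16) (u k)"
    and e: "\<And>k i. e k i = 2 ^ k * (u k (i + 1) - u k i)"
    and init: "\<And>i. \<bar>e 0 (i + 1) - e 0 i\<bar> \<le> B"
  shows "\<bar>e k (i + 1) - e k i\<bar> \<le> 10/9 * B * (9/10) ^ k"
    and "\<bar>e (Suc k) j - e k (j div 2)\<bar> \<le> 10/9 * B * (9/10) ^ k"
proof -
  have e_even: "e (Suc k) (2 * i) = e k i + (e k (i - 1) - e k (i + 1)) / 8" for k i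
    unfolding e u L4_odd_sixteenth L4_even by (simp add: field_simps)
  have e_odd: "e (Suc k) (2 * i + 1) = e k i - (e k (i - 1) - e k (i + 1)) / 8" for k i
  proof -
    have "L4 (1/16) (u k) (2 * i + 1 + 1) = u k (i + 1)"
      using L4_even[of "1/16" "u k" "i + 1"] by (simp add: algebra_simps)
    then show ?thesis unfolding e u L4_odd_sixteenth by (simp add: field_simps)
  qed
  have step: "\<bar>e k (i + 1) - e k i\<bar> \<le> 10/9 * B * (9/10) ^ k" for k i
  proof (rule two_step_decay[of "\<lambda>k i. e k (i + 1) - e k i"])
    fix k i
    show "e (Suc k) (2 * i + 1) - e (Suc k) (2 * i)
        = (e k (i - 1 + 1) - e k (i - 1) + (e k (i + 1) - e k i)) / 4"
      unfolding e_even e_odd by (simp add: field_simps)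
    have "e (Suc k) (2 * i + 1 + 1)
        = e k (i + 1) + (e k i - e k (i + 2)) / 8"
      using e_even[of k "i + 1"] by (simp add: algebra_simps)
    then show "e (Suc k) (2 * i + 1 + 1) - e (Suc k) (2 * i + 1)
        = (6 * (e k (i + 1) - e k i) - (e k (i - 1 + 1) - e k (i - 1))
            - (e k (i + 1 + 1) - e k (i + 1))) / 8"
      unfolding e_odd by (simp add: field_simps)
  qed (rule init)
  then show "\<bar>e k (i + 1) - e k i\<bar> \<le> 10/9 * B * (9/10) ^ k" .
  obtain i where "j = 2 * i \<or> j = 2 * i + 1" by (metis oddE evenE)
  then have "\<bar>e (Suc k) j - e k (j div 2)\<bar> = \<bar>e k (i + 1) - e k (i - 1)\<bar> / 8"
    by (auto simp: e_even e_odd abs_minus_commute)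
  moreover define D where "D = 10/9 * B * (9/10) ^ k"
  have "\<bar>e k (i + 1) - e k (i - 1)\<bar> \<le> 2 * D" "0 \<le> D"
    using step[of k i] step[of k "i - 1"] unfolding diff_add_cancel D_def by linarith+
  ultimately show "\<bar>e (Suc k) j - e k (j div 2)\<bar> \<le> 10/9 * B * (9/10) ^ k"
    unfolding D_def[symmetric] by simp
qed

lemma L4_limit_C1:
  fixes u :: "nat \<Rightarrow> int \<Rightarrow> real"
  assumes u: "\<And>k. u (Suc k) = L4 (1/16) (u k)" and bounded: "\<And>i. \<bar>u 0 i\<bar> \<le> C"
  obtains f where "f C1_differentiable_on UNIV"
    and "uniform_limit UNIV (\<lambda>k. pl_interp k (u k)) f sequentially"
proof -
  have init: "\<bar>u 0 (i + 1) - u 0 i\<bar> \<le> 2 * C" for i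
    using bounded[of i] bounded[of "i + 1"] by linarith
  have "\<bar>u (Suc k) j - L4 (1/16) (u k) j\<bar> \<le> 0 * (3/4) ^ k" for k j by (simp add: u)
  note u_bounds = perturbed_L4_geometric_bounds[of u 0 "2 * C", OF this init]
  have "\<exists>f. continuous_on UNIV f \<and> uniform_limit UNIV (\<lambda>k. pl_interp k (u k)) f sequentially"
    using u_bounds by (intro interpolants_converge_uniformly[of "3/4" u "2 * C"]) simp_all
  then obtain f where lim_u: "uniform_limit UNIV (\<lambda>k. pl_interp k (u k)) f sequentially"
    by blast
  define e where "e k i = 2 ^ k * (u k (i + 1) - u k i)" for k i
  have "\<bar>e 0 (i + 1) - e 0 i\<bar> \<le> 4 * C" for i
    unfolding e_def using init[of i] init[of "i + 1"] by simp
  note e_bounds = L4_divided_difference_bounds[of u e, OF u e_def this]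
  have "\<exists>g. continuous_on UNIV g \<and> uniform_limit UNIV (\<lambda>k. pl_interp k (e k)) g sequentially"
    using e_bounds
    by (intro interpolants_converge_uniformly[of "9/10" e "10/9 * (4 * C)"]) simp_all
  then obtain g where g: "continuous_on UNIV g"
    and lim_e: "uniform_limit UNIV (\<lambda>k. pl_interp k (e k)) g sequentially"
    by blast
  have "(f has_vector_derivative g t) (at t)" for t
  proof (rule limit_of_interpolants_has_derivative[of e u, OF _ _ _ _ lim_e g])
    show "e k i = 2 ^ k *\<^sub>R (u k (i + 1) - u k i)" for k i by (simp add: e_def)
    show "norm (e k (i + 1) - e k i) \<le> 10/9 * (4 * C) * (9/10) ^ k" for k i
      using e_bounds by simp
    show "(\<lambda>k. 10/9 * (4 * C) * (9/10) ^ k) \<longlonglongrightarrow> 0"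
      by (intro tendsto_mult_right_zero LIMSEQ_realpow_zero) auto
    show "(\<lambda>k. pl_interp k (u k) t) \<longlonglongrightarrow> f t" for t
      by (rule tendsto_uniform_limitI[OF lim_u]) simp
  qed
  then have "f C1_differentiable_on UNIV" using g by (auto simp: C1_differentiable_on_def)
  then show ?thesis using lim_u that by blast
qed


section \<open>The Heisenberg scheme\<close>

lemma xs_of_S_H: "xs_of (S_H \<omega> P) = L4 \<omega> (xs_of P)"
  by (rule ext) (simp add: xs_of_def S_H_def L4_def)

lemma ys_of_S_H: "ys_of (S_H \<omega> P) = L4 \<omega> (ys_of P)"
  by (rule ext) (simp add: ys_of_def S_H_def L4_def)

lemma zs_of_S_H:
  "zs_of (S_H \<omega> P) j =
    L4 \<omega> (zs_of P) j + (if even j then 0 else heis_correction \<omega> P (j div 2))"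
  by (simp add: zs_of_def S_H_def L4_def)

lemma coordinates_le_norm:
  "\<bar>xs_of P i\<bar> \<le> norm (P i)" "\<bar>ys_of P i\<bar> \<le> norm (P i)" "\<bar>zs_of P i\<bar> \<le> norm (P i)"
proof -
  show "\<bar>xs_of P i\<bar> \<le> norm (P i)"
    using norm_fst_le[of "fst (P i)" "snd (P i)"] by (simp add: xs_of_def)
  have snd: "norm (snd (P i)) \<le> norm (P i)"
    using norm_snd_le[of "snd (P i)" "fst (P i)"] by simp
  show "\<bar>ys_of P i\<bar> \<le> norm (P i)"
    using norm_fst_le[of "fst (snd (P i))" "snd (snd (P i))"] snd by (simp add: ys_of_def)
  show "\<bar>zs_of P i\<bar> \<le> norm (P i)"
    using norm_snd_le[of "snd (snd (P i))" "fst (snd (P i))"] snd by (simp add: zs_of_def)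
qed

lemma abs_heis_correction_le:
  assumes "\<bar>xs_of P i\<bar> \<le> K" "\<bar>ys_of P i\<bar> \<le> K"
    and "\<bar>L4 \<omega> (xs_of P) (2 * i + 1) - xs_of P i\<bar> \<le> D"
    and "\<bar>L4 \<omega> (ys_of P) (2 * i + 1) - ys_of P i\<bar> \<le> D"
  shows "\<bar>heis_correction \<omega> P i\<bar> \<le> K * D"
proof -
  define a b where "a = L4 \<omega> (xs_of P) (2 * i + 1) - xs_of P i"
    and "b = L4 \<omega> (ys_of P) (2 * i + 1) - ys_of P i"
  have "\<bar>xs_of P i * b\<bar> \<le> K * D" "\<bar>ys_of P i * a\<bar> \<le> K * D"
    unfolding abs_mult using assms by (auto intro!: mult_mono simp: a_def b_def)
  then have "\<bar>xs_of P i * b - ys_of P i * a\<bar> \<le> 2 * (K * D)" by linarith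
  then show ?thesis by (simp add: heis_correction_def Let_def a_def b_def)
qed

lemma uniform_limit_Pair:
  assumes "uniform_limit S f f' F" and "uniform_limit S g g' F"
  shows "uniform_limit S (\<lambda>n x. (f n x, g n x)) (\<lambda>x. (f' x, g' x)) F"
proof (rule uniform_limitI)
  fix \<epsilon> :: real assume "\<epsilon> > 0"
  then have "\<epsilon> / 2 > 0" by simp
  show "\<forall>\<^sub>F n in F. \<forall>x\<in>S. dist (f n x, g n x) (f' x, g' x) < \<epsilon>"
    using uniform_limitD[OF assms(1) \<open>\<epsilon> / 2 > 0\<close>] uniform_limitD[OF assms(2) \<open>\<epsilon> / 2 > 0\<close>]
  proof eventually_elim
    case (elim n)
    show ?case
    proof
      fix x assume "x \<in> S"
      have "dist (f n x, g n x) (f' x, g' x) \<le> dist (f n x) (f' x) + dist (g n x) (g' x)"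
        unfolding dist_Pair_Pair by (rule sqrt_sum_squares_le_sum) auto
      also have "\<dots> < \<epsilon>" using elim \<open>x \<in> S\<close> by fastforce
      finally show "dist (f n x, g n x) (f' x, g' x) < \<epsilon>" .
    qed
  qed
qed

text \<open>The scheme is triangular: \<open>x\<close> and \<open>y\<close> do not see \<open>z\<close>, so their bounds are available first and
  turn the nonlinear correction into a known perturbation of the linear scheme for \<open>z\<close>.\<close>

lemma heisenberg_scheme_converges:
  fixes P :: "nat \<Rightarrow> int \<Rightarrow> point"
  assumes bounded: "\<And>i. norm (P 0 i) \<le> C" and P: "\<And>k. P (Suc k) = S_H (1/16) (P k)"
  obtains X Y Z where "X C1_differentiable_on UNIV" "Y C1_differentiable_on UNIV"
    and "continuous_on UNIV Z"
    and "uniform_limit UNIV (\<lambda>k. pl_interp k (xs_of (P k))) X sequentially"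
    and "uniform_limit UNIV (\<lambda>k. pl_interp k (ys_of (P k))) Y sequentially"
    and "uniform_limit UNIV (\<lambda>k. pl_interp k (zs_of (P k))) Z sequentially"
proof -
  note coords = order_trans[OF coordinates_le_norm(1) bounded]
    order_trans[OF coordinates_le_norm(2) bounded] order_trans[OF coordinates_le_norm(3) bounded]
  have x: "xs_of (P (Suc k)) = L4 (1/16) (xs_of (P k))"
    and y: "ys_of (P (Suc k)) = L4 (1/16) (ys_of (P k))" for k
    by (simp_all add: P xs_of_S_H ys_of_S_H)
  obtain X where X: "X C1_differentiable_on UNIV"
      "uniform_limit UNIV (\<lambda>k. pl_interp k (xs_of (P k))) X sequentially"
    using L4_limit_C1[of "\<lambda>k. xs_of (P k)", OF x coords(1)] by blast
  obtain Y where Y: "Y C1_differentiable_on UNIV"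
      "uniform_limit UNIV (\<lambda>k. pl_interp k (ys_of (P k))) Y sequentially"
    using L4_limit_C1[of "\<lambda>k. ys_of (P k)", OF y coords(2)] by blast

  have "\<bar>w (P 0) (i + 1) - w (P 0) i\<bar> \<le> 2 * C"
    if "\<And>i. \<bar>w (P 0) i\<bar> \<le> C" for w :: "(int \<Rightarrow> point) \<Rightarrow> int \<Rightarrow> real" and i
    using that[of i] that[of "i + 1"] by linarith
  note init = this[of xs_of, OF coords(1)] this[of ys_of, OF coords(2)] this[of zs_of, OF coords(3)]
  have x_parent: "\<bar>xs_of (P (Suc k)) j - xs_of (P k) (j div 2)\<bar> \<le> 2 * C * (3/4) ^ k"
    and y_parent: "\<bar>ys_of (P (Suc k)) j - ys_of (P k) (j div 2)\<bar> \<le> 2 * C * (3/4) ^ k" for k j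
    using perturbed_L4_geometric_bounds(2)[of "\<lambda>k. xs_of (P k)" 0 "2 * C"]
      perturbed_L4_geometric_bounds(2)[of "\<lambda>k. ys_of (P k)" 0 "2 * C"] init
    by (simp_all add: x y)
  \<comment> \<open>\<open>2 C\<close> bounds the initial differences, hence is the constant of the parent bounds, and
    \<open>C + 4 (2 C)\<close> bounds all values at all levels.\<close>
  define K where "K = C + 4 * (2 * C)"
  have x_le: "\<bar>xs_of (P k) i\<bar> \<le> K" and y_le: "\<bar>ys_of (P k) i\<bar> \<le> K" for k i
    unfolding K_def
    by (rule bounded_of_near_parent[of "\<lambda>k. xs_of (P k)", OF coords(1) x_parent],
        rule bounded_of_near_parent[of "\<lambda>k. ys_of (P k)", OF coords(2) y_parent])
  have correction: "\<bar>heis_correction (1/16) (P k) i\<bar> \<le> K * (2 * C * (3/4) ^ k)" for k i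
    using x_parent[of k "2 * i + 1"] y_parent[of k "2 * i + 1"]
    by (intro abs_heis_correction_le x_le y_le) (simp_all add: x y)
  define M where "M = K * (2 * C)"
  have "0 \<le> M * (3/4) ^ k" for k
    using correction[of k 0] unfolding M_def by (simp add: mult_ac)
  then have "\<bar>zs_of (P (Suc k)) j - L4 (1/16) (zs_of (P k)) j\<bar> \<le> M * (3/4) ^ k" for k j
    using correction[of k "j div 2"] by (simp add: P zs_of_S_H M_def mult_ac)
  note z_bounds = perturbed_L4_geometric_bounds[of "\<lambda>k. zs_of (P k)", OF this init(3)]
  have "\<exists>Z. continuous_on UNIV Z \<and>
      uniform_limit UNIV (\<lambda>k. pl_interp k (zs_of (P k))) Z sequentially"
    using z_bounds
    by (intro interpolants_converge_uniformly[of "3/4" "\<lambda>k. zs_of (P k)" "16 * M + 2 * C"]) simp_all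
  then obtain Z where Z: "continuous_on UNIV Z"
      "uniform_limit UNIV (\<lambda>k. pl_interp k (zs_of (P k))) Z sequentially"
    by blast
  show ?thesis by (rule that[OF X(1) Y(1) Z(1) X(2) Y(2) Z(2)])
qed

theorem theorem5p8:
  "\<exists>\<epsilon>0::real. \<epsilon>0 > 0 \<and>
    (\<forall>(C::real) (P :: nat \<Rightarrow> int \<Rightarrow> point).
      sup_norm (P 0) \<le> ereal C \<longrightarrow>
      norm_Delta_h (P 0) \<le> ereal \<epsilon>0 \<longrightarrow>
      norm_Delta2_h (P 0) \<le> ereal \<epsilon>0 \<longrightarrow>
      (\<forall>k. P (Suc k) = S_H (1/16) (P k)) \<longrightarrow>
      (\<exists>X Y Z :: real \<Rightarrow> real.
        dyadic_limit P (\<lambda>t. (X t, Y t, Z t)) \<and>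
        X C1_differentiable_on UNIV \<and>
        Y C1_differentiable_on UNIV \<and>
        continuous_on UNIV Z \<and>
        dyadic_limit (\<lambda>k. (L4 (1/16) ^^ k) (xs_of (P 0))) X \<and>
        dyadic_limit (\<lambda>k. (L4 (1/16) ^^ k) (ys_of (P 0))) Y \<and>
        dyadic_limit (\<lambda>k. zs_of (P k)) Z))"
proof (rule exI[of _ 1], intro conjI allI impI)
  fix C :: real and P :: "nat \<Rightarrow> int \<Rightarrow> point"
  assume "sup_norm (P 0) \<le> ereal C" and "\<forall>k. P (Suc k) = S_H (1/16) (P k)"
  then have bounded: "norm (P 0 i) \<le> C" and P: "P (Suc k) = S_H (1/16) (P k)" for i k
    by (simp_all add: sup_norm_def SUP_le_iff)
  obtain X Y Z where C1: "X C1_differentiable_on UNIV" "Y C1_differentiable_on UNIV"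
    and Z: "continuous_on UNIV Z"
    and lim: "uniform_limit UNIV (\<lambda>k. pl_interp k (xs_of (P k))) X sequentially"
      "uniform_limit UNIV (\<lambda>k. pl_interp k (ys_of (P k))) Y sequentially"
      "uniform_limit UNIV (\<lambda>k. pl_interp k (zs_of (P k))) Z sequentially"
    by (rule heisenberg_scheme_converges[of P C, OF bounded P])
  have dyadic: "dyadic_limit u f"
    if "uniform_limit UNIV (\<lambda>k. pl_interp k (u k)) f sequentially"
    for u :: "nat \<Rightarrow> int \<Rightarrow> 'b::real_normed_vector" and f
    unfolding dyadic_limit_def using that by (meson uniform_limit_on_subset subset_UNIV)
  have iterate: "(L4 (1/16) ^^ k) (xs_of (P 0)) = xs_of (P k)"
    "(L4 (1/16) ^^ k) (ys_of (P 0)) = ys_of (P k)" for k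
    by (induction k) (simp_all add: P xs_of_S_H ys_of_S_H)
  have "pl_interp k (P k) = (\<lambda>t. (pl_interp k (xs_of (P k)) t,
      pl_interp k (ys_of (P k)) t, pl_interp k (zs_of (P k)) t))" for k
    unfolding pl_interp_Pair[symmetric] by (simp add: xs_of_def ys_of_def zs_of_def)
  then have "uniform_limit UNIV (\<lambda>k. pl_interp k (P k)) (\<lambda>t. (X t, Y t, Z t)) sequentially"
    using uniform_limit_Pair[OF lim(1) uniform_limit_Pair[OF lim(2,3)]] by simp
  then show "\<exists>X Y Z :: real \<Rightarrow> real.
        dyadic_limit P (\<lambda>t. (X t, Y t, Z t)) \<and>
        X C1_differentiable_on UNIV \<and>
        Y C1_differentiable_on UNIV \<and>
        continuous_on UNIV Z \<and>
        dyadic_limit (\<lambda>k. (L4 (1/16) ^^ k) (xs_of (P 0))) X \<and>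
        dyadic_limit (\<lambda>k. (L4 (1/16) ^^ k) (ys_of (P 0))) Y \<and>
        dyadic_limit (\<lambda>k. zs_of (P k)) Z"
    unfolding iterate using C1 Z dyadic[OF lim(1)] dyadic[OF lim(2)] dyadic[OF lim(3)]
    by (intro exI conjI) (rule dyadic)
qed simp

end
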